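(* Let $G$ be a finite connected graph satisfying $CD(K,\infty)$ for some $K>0$. Then there exists no infinite covering of $G$ preserving all 3-cycles and 4-cycles; that is, there is no covering $(\widetilde G,\Psi)$ of $G$ with $\widetilde G$ infinite that is $\mathcal B$ preserving, where $\mathcal B$ is the set of all circuits of $G$ of length 3 or 4.
   Context: Graphs are simple and undirected; $x\sim y$ means $x$ and $y$ are adjacent. Curvature. For $f:V\to\mathbb R$ put $\Delta f(x)=\sum_{y\sim x}(f(y)-f(x))$, and for $f,g:V\to\mathbb R$ put $\Gamma(f,g)=\frac12(\Delta(fg)-f\Delta g-g\Delta f)$, $\Gamma_2(f,g)=\frac12(\Delta\Gamma(f,g)-\Gamma(f,\Delta g)-\Gamma(g,\Delta f))$, $\Gamma(f)=\Gamma(f,f)$, $\Gamma_2(f)=\Gamma_2(f,f)$. $G$ satisfies $CD(K,\infty)$ if $\Gamma_2(f)\ge K\,\Gamma(f)$ holds at every vertex for all $f:V\to\mathbb R$. Coverings. A circuit $C=(x_1,\dots,x_n)$ is a simple closed walk (simple cycle, $n\ge3$). For a connected graph $G$, a covering of $G$ is a pair $(\widetilde G,\Psi)$ where $\widetilde G$ is a graph and $\Psi:\widetilde G\to G$ is a surjective graph homomorphism that is locally bijective, i.e. for each vertex $\widetilde x$ it maps the neighbors of $\widetilde x$ bijectively onto the neighbors of $\Psi(\widetilde x)$. For a set $\mathcal B$ of circuits of $G$, the covering is $\mathcal B$ preserving if for all $C=(x_1,\dots,x_n)\in\mathcal B$ and all vertices $\widetilde x_1$ of $\widetilde G$ with $\Psi(\widetilde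 x_1)=x_1$ there is a circuit $(\widetilde x_1,\dots,\widetilde x_n)$ in $\widetilde G$ with $\Psi(\widetilde x_k)=x_k$ for all $k$.
   Formalization: The covering graph is required to be connected; without this the claim fails, since infinitely many disjoint copies of G form an infinite covering of G preserving all 3-cycles and 4-cycles. *)

theory Defs
  imports Complex_Main "Graph_Theory.Graph_Theory"
begin

text \<open>
  A simple undirected graph is a loop-free symmetric pair digraph: \<^locale>\<open>pair_bidirected_digraph\<close>
  (vertex set possibly infinite), or \<^locale>\<open>pair_graph\<close> (finite). Graphs are coerced silently along
  \<^const>\<open>with_proj\<close> to the digraphs on which the library states adjacency, walks and
  connectedness. The library's connectedness includes nonemptiness.
\<close>

definition nbrs :: "'a pair_pre_digraph \<Rightarrow> 'a \<Rightarrow> 'a set" where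
  "nbrs G x = {y. x \<rightarrow>\<^bsub>G\<^esub> y}"

subsection \<open>Bakry--Emery curvature\<close>

text \<open>
  Functions on the vertex set are functions on the whole vertex type. At a vertex of the graph
  the operators below only depend on the values at vertices of the graph.
\<close>

definition laplace :: "'a pair_pre_digraph \<Rightarrow> ('a \<Rightarrow> real) \<Rightarrow> 'a \<Rightarrow> real" where
  "laplace G f x = (\<Sum>y\<in>nbrs G x. f y - f x)"

definition Gam :: "'a pair_pre_digraph \<Rightarrow> ('a \<Rightarrow> real) \<Rightarrow> ('a \<Rightarrow> real) \<Rightarrow> 'a \<Rightarrow> real" where
  "Gam G f g x =
     1/2 * (laplace G (\<lambda>y. f y * g y) x - f x * laplace G g x - g x * laplace G f x)"

definition Gam2 :: "'a pair_pre_digraph \<Rightarrow> ('a \<Rightarrow> real) \<Rightarrow> ('a \<Rightarrow> real) \<Rightarrow> 'a \<Rightarrow> real" where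
  "Gam2 G f g x =
     1/2 * (laplace G (Gam G f g) x - Gam G f (laplace G g) x - Gam G g (laplace G f) x)"

definition CD_inf :: "'a pair_pre_digraph \<Rightarrow> real \<Rightarrow> bool" where
  "CD_inf G K \<longleftrightarrow> (\<forall>f :: 'a \<Rightarrow> real. \<forall>x\<in>pverts G. Gam2 G f f x \<ge> K * Gam G f f x)"

subsection \<open>Circuits and coverings\<close>

text \<open>
  The circuit $(x_1,\dots,x_n)$ is the list of its $n$ distinct vertices, without repeating
  $x_1$ at the end. So \<^term>\<open>length xs\<close> is the length of the circuit.
\<close>

definition circuit :: "'a pair_pre_digraph \<Rightarrow> 'a list \<Rightarrow> bool" where
  "circuit G xs \<longleftrightarrow> 3 \<le> length xs \<and> vpath xs G \<and> last xs \<rightarrow>\<^bsub>G\<^esub> hd xs"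

definition graph_hom :: "'a pair_pre_digraph \<Rightarrow> 'b pair_pre_digraph \<Rightarrow> ('a \<Rightarrow> 'b) \<Rightarrow> bool" where
  "graph_hom H G \<Psi> \<longleftrightarrow>
     (\<forall>x\<in>pverts H. \<Psi> x \<in> pverts G) \<and> (\<forall>x y. x \<rightarrow>\<^bsub>H\<^esub> y \<longrightarrow> \<Psi> x \<rightarrow>\<^bsub>G\<^esub> \<Psi> y)"

text \<open>
  As in the source, connectedness of the covering graph is not part of this definition. A statement
  that excludes infinite coverings has to ask for it separately: infinitely many disjoint copies of
  a graph always cover that graph and preserve all of its circuits.
\<close>

definition covering :: "'a pair_pre_digraph \<Rightarrow> 'b pair_pre_digraph \<Rightarrow> ('b \<Rightarrow> 'a) \<Rightarrow> bool" where
  "covering G H \<Psi> \<longleftrightarrow>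
     pair_bidirected_digraph H \<and>
     graph_hom H G \<Psi> \<and>
     \<Psi> ` pverts H = pverts G \<and>
     (\<forall>x\<in>pverts H. bij_betw \<Psi> (nbrs H x) (nbrs G (\<Psi> x)))"

definition preserving :: "'a list set \<Rightarrow> 'b pair_pre_digraph \<Rightarrow> ('b \<Rightarrow> 'a) \<Rightarrow> bool" where
  "preserving B H \<Psi> \<longleftrightarrow>
     (\<forall>xs\<in>B. \<forall>y\<in>pverts H. \<Psi> y = hd xs \<longrightarrow>
        (\<exists>ys. circuit H ys \<and> hd ys = y \<and> map \<Psi> ys = xs))"

end

theory Submission
  imports Defs
begin

text \<open>
  The curvature condition at a vertex involves only the ball of radius two around it. A covering
  that preserves 3-circuits and 4-circuits is injective on such balls
  (\<open>inj_on_two_ball\<close>): unless local injectivity already separates them, two vertices of a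
  two-ball with the same image would give a path whose image closes up to a circuit of length 3 or 4
  that does not lift. Hence a function
  on a two-ball upstairs is the pullback of a function on the base, and the covering graph inherits
  $CD(K,\infty)$ (\<open>CD_inf_lift\<close>). It also inherits the bound $D$ on the vertex degrees.

  It remains to see that a connected graph with degrees at most $D$ and $CD(K,\infty)$, $K > 0$, is
  finite (\<open>finite_pverts\<close>). This is a Bonnet--Myers theorem, usually proved with the
  gradient estimate $\Gamma(P_t f) \le e^{-2Kt} P_t\Gamma(f)$ for the heat semigroup. A single explicit
  Euler step $f + e\,\Delta f$ with a small $e > 0$ can replace the semigroup: if $\Gamma(f) \le 1$
  everywhere, then $\Gamma(f + e\,\Delta f) \le 1 - eK$ everywhere
  (\<open>Euler_step_contracts_gradient\<close>), while the step moves the values of $f$ by at most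
  $2De$. Let $M$ be the supremum of $|f(x) - f(y)|$ over all $f$ with $\Gamma(f) \le 1$. Comparing $f$ with the
  result of the step gives $M \le \sqrt{1 - eK}\,M + 4De$, a bound on $M$ that does not depend on $x$ and $y$
  (\<open>unit_gradient_bounded_oscillation\<close>). Since multiples of distance functions compete in
  this supremum, the diameter is bounded, and a graph of bounded degree and bounded diameter is finite.
\<close>

section \<open>The carre du champ as a sum of squares\<close>

lemma Gam_eq_sum: "Gam G f g x = 1/2 * (\<Sum>y\<in>nbrs G x. (f y - f x) * (g y - g x))"
proof -
  have "laplace G (\<lambda>y. f y * g y) x - f x * laplace G g x - g x * laplace G f x
      = (\<Sum>y\<in>nbrs G x. (f y * g y - f x * g x) - f x * (g y - g x) - g x * (f y - f x))"
    unfolding laplace_def by (simp only: sum_distrib_left sum_subtractf [symmetric])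
  also have "\<dots> = (\<Sum>y\<in>nbrs G x. (f y - f x) * (g y - g x))"
    by (intro sum.cong refl) (simp add: algebra_simps)
  finally show ?thesis by (simp add: Gam_def)
qed

lemma Gam_add_scaled:
  "Gam G (\<lambda>x. f x + e * g x) (\<lambda>x. f x + e * g x) x =
     Gam G f f x + 2 * e * Gam G f g x + e^2 * Gam G g g x"
proof -
  have "(\<Sum>y\<in>nbrs G x. ((f y + e * g y) - (f x + e * g x)) * ((f y + e * g y) - (f x + e * g x)))
     = (\<Sum>y\<in>nbrs G x. (f y - f x) * (f y - f x) + 2 * e * ((f y - f x) * (g y - g x))
          + e^2 * ((g y - g x) * (g y - g x)))"
    by (intro sum.cong refl) (simp add: algebra_simps power2_eq_square)
  also have "\<dots> = (\<Sum>y\<in>nbrs G x. (f y - f x) * (f y - f x))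
      + 2 * e * (\<Sum>y\<in>nbrs G x. (f y - f x) * (g y - g x))
      + e^2 * (\<Sum>y\<in>nbrs G x. (g y - g x) * (g y - g x))"
    by (simp only: sum.distrib sum_distrib_left)
  finally show ?thesis by (simp add: Gam_eq_sum algebra_simps)
qed

lemma Gam_divide: "Gam G (\<lambda>x. f x / r) (\<lambda>x. f x / r) x = Gam G f f x / r^2"
  by (simp add: Gam_eq_sum sum_divide_distrib power2_eq_square mult.commute [of _ 2]
      flip: diff_divide_distrib)

lemma Gam2_self: "Gam2 G f f x = 1/2 * laplace G (Gam G f f) x - Gam G f (laplace G f) x"
  by (simp add: Gam2_def)

section \<open>Positive curvature and bounded degree force finiteness\<close>

locale positively_curved = pair_sym_digraph H
  for H :: "'b pair_pre_digraph" +
  fixes K D :: real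
  assumes finite_nbrs: "x \<in> pverts H \<Longrightarrow> finite (nbrs H x)"
    and card_nbrs: "x \<in> pverts H \<Longrightarrow> real (card (nbrs H x)) \<le> D"
    and D_pos: "D > 0"
    and K_pos: "K > 0"
    and CD: "CD_inf H K"
begin

lemma nbr_in_pverts: "y \<in> nbrs H x \<Longrightarrow> y \<in> pverts H"
  using in_arcsD2 by (auto simp: nbrs_def)

lemma sum_nbrs_le:
  assumes "x \<in> pverts H" "\<And>y. y \<in> nbrs H x \<Longrightarrow> g y \<le> c" "c \<ge> 0"
  shows "sum g (nbrs H x) \<le> D * c"
proof -
  have "sum g (nbrs H x) \<le> real (card (nbrs H x)) * c"
    by (intro sum_bounded_above assms)
  also have "\<dots> \<le> D * c"
    by (intro mult_right_mono card_nbrs assms)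
  finally show ?thesis .
qed

lemma Gam_le_of_Lipschitz:
  assumes "x \<in> pverts H" "\<And>y. y \<in> nbrs H x \<Longrightarrow> \<bar>g y - g x\<bar> \<le> c"
  shows "Gam H g g x \<le> D * c^2 / 2"
proof -
  have "(\<Sum>y\<in>nbrs H x. (g y - g x) * (g y - g x)) \<le> D * c^2"
  proof (rule sum_nbrs_le)
    fix y assume "y \<in> nbrs H x"
    then have "\<bar>g y - g x\<bar>^2 \<le> c^2" using assms by (intro power_mono) auto
    then show "(g y - g x) * (g y - g x) \<le> c^2" by (simp add: power2_eq_square)
  qed (use assms in auto)
  then show ?thesis by (simp add: Gam_eq_sum)
qed

definition unit_gradient :: "('b \<Rightarrow> real) \<Rightarrow> bool" where
  "unit_gradient f \<longleftrightarrow> (\<forall>x\<in>pverts H. Gam H f f x \<le> 1)"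

lemma unit_gradient_step:
  assumes "unit_gradient f" "x \<in> pverts H" "y \<in> nbrs H x"
  shows "\<bar>f y - f x\<bar> \<le> 2"
proof -
  have "(f y - f x)^2 \<le> (\<Sum>y\<in>nbrs H x. (f y - f x)^2)"
    using assms finite_nbrs by (intro member_le_sum) auto
  also have "\<dots> = 2 * Gam H f f x" by (simp add: Gam_eq_sum power2_eq_square)
  also have "\<dots> \<le> 2^2" using assms by (force simp: unit_gradient_def)
  finally show ?thesis by (metis abs_le_square_iff abs_numeral)
qed

lemma laplace_le:
  assumes "unit_gradient f" "x \<in> pverts H"
  shows "\<bar>laplace H f x\<bar> \<le> 2 * D"
proof -
  have "\<bar>laplace H f x\<bar> \<le> (\<Sum>y\<in>nbrs H x. \<bar>f y - f x\<bar>)"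
    unfolding laplace_def by (rule sum_abs)
  also have "\<dots> \<le> D * 2"
    using assms unit_gradient_step by (intro sum_nbrs_le) auto
  finally show ?thesis by simp
qed

lemma Gam_laplace_le:
  assumes "unit_gradient f" "x \<in> pverts H"
  shows "Gam H (laplace H f) (laplace H f) x \<le> 8 * D^3"
proof -
  have "Gam H (laplace H f) (laplace H f) x \<le> D * (4 * D)^2 / 2"
  proof (rule Gam_le_of_Lipschitz)
    fix y assume "y \<in> nbrs H x"
    then show "\<bar>laplace H f y - laplace H f x\<bar> \<le> 4 * D"
      using laplace_le [OF assms] laplace_le [OF assms(1), of y] nbr_in_pverts [of y x] by linarith
  qed fact
  then show ?thesis by (simp add: power2_eq_square power3_eq_cube)
qed

text \<open>
  The curvature bound enters here: $\Gamma(f,\Delta f) = \frac12\Delta\Gamma(f) - \Gamma_2(f)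
  \le \frac12\Delta\Gamma(f) - K\,\Gamma(f)$. An explicit Euler step of size \<^term>\<open>e\<close> of the
  heat flow therefore decreases the supremum of the gradient to first order in \<^term>\<open>e\<close>. The
  quadratic error $e^2\,\Gamma(\Delta f)$ is not controlled pointwise by $\Gamma(f)$, but it is
  controlled by its supremum, which bounded degree makes enough.
\<close>
lemma Euler_step_contracts_gradient:
  assumes f: "unit_gradient f" and x: "x \<in> pverts H"
    and e: "e > 0" "e * (D + 2 * K) \<le> 1" "e * (8 * D^3) \<le> K"
  defines "g \<equiv> \<lambda>z. f z + e * laplace H f z"
  shows "Gam H g g x \<le> 1 - e * K"
proof -
  let ?s = "1 - Gam H f f x"
  have s: "0 \<le> ?s" using f x by (simp add: unit_gradient_def)
  have "laplace H (Gam H f f) x \<le> D * ?s"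
    unfolding laplace_def
    using f x s nbr_in_pverts by (intro sum_nbrs_le) (auto simp: unit_gradient_def)
  moreover have "Gam2 H f f x \<ge> K * Gam H f f x"
    using CD x by (simp add: CD_inf_def)
  ultimately have "2 * Gam H f (laplace H f) x \<le> D * ?s - 2 * K * Gam H f f x"
    by (simp add: Gam2_self)
  then have "e * (2 * Gam H f (laplace H f) x) \<le> e * (D * ?s - 2 * K * Gam H f f x)"
    using e by (intro mult_left_mono) auto
  moreover have "e^2 * Gam H (laplace H f) (laplace H f) x \<le> e^2 * (8 * D^3)"
    using Gam_laplace_le [OF f x] by (intro mult_left_mono) auto
  moreover have "e^2 * (8 * D^3) \<le> e * K"
    using mult_left_mono [OF e(3), of e] e(1) by (simp add: power2_eq_square mult.assoc)
  moreover have "e * (D + 2 * K) * ?s \<le> 1 * ?s"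
    using e(2) s by (rule mult_right_mono)
  ultimately show ?thesis
    unfolding g_def Gam_add_scaled by (simp add: algebra_simps)
qed

text \<open>
  This bound grows with the distance. It serves to make the supremum
  in \<open>unit_gradient_bounded_oscillation\<close> a real number.
\<close>
lemma unit_gradient_path:
  assumes "unit_gradient f" "x \<in> pverts H" "(x, y) \<in> parcs H ^^ n"
  shows "\<bar>f x - f y\<bar> \<le> 2 * real n"
  using assms(3)
proof (induction n arbitrary: y)
  case (Suc n)
  then obtain z where z: "(x, z) \<in> parcs H ^^ n" "(z, y) \<in> parcs H" by auto
  then have "y \<in> nbrs H z" "z \<in> pverts H"
    using in_arcsD1 by (auto simp: nbrs_def)
  then have "\<bar>f y - f z\<bar> \<le> 2" using assms unit_gradient_step by blast
  with Suc.IH [OF z(1)] show ?case by simp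
qed simp

text \<open>
  For fixed vertices let $M$ be the supremum of the differences of values of functions with
  $\Gamma \le 1$. The Euler step changes such a function by at most \<^term>\<open>2 * D * e\<close> and leaves it,
  up to a factor $r < 1$, in the same class. So $M \le r M + 4De$, and this bounds $M$
  independently of the two vertices.
\<close>
lemma unit_gradient_bounded_oscillation:
  assumes conn: "\<And>x y. x \<in> pverts H \<Longrightarrow> y \<in> pverts H \<Longrightarrow> (x, y) \<in> (parcs H)\<^sup>*"
  obtains B where "\<And>f x y. unit_gradient f \<Longrightarrow> x \<in> pverts H \<Longrightarrow> y \<in> pverts H \<Longrightarrow>
    \<bar>f x - f y\<bar> \<le> B"
proof -
  \<comment> \<open>the two conditions on the step size in the contraction estimate ask for
    $1/e \ge D + 2K$ and $1/e \ge 8D^3/K$\<close>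
  define e where "e = 1 / (D + 2 * K + 8 * D^3 / K)"
  have "8 * D^3 / K > 0" using D_pos K_pos by simp
  then have den: "D + 2 * K + 8 * D^3 / K > 0" "8 * D^3 / K > 0" using D_pos K_pos by linarith+
  then have e: "e > 0" by (simp add: e_def)
  have e2: "e * (D + 2 * K) \<le> 1"
    unfolding e_def times_divide_eq_left mult_1 divide_le_eq_1_pos [OF den(1)]
    using den(2) by linarith
  have "e * (8 * D^3 / K) \<le> 1"
    unfolding e_def times_divide_eq_left mult_1 divide_le_eq_1_pos [OF den(1)]
    using D_pos K_pos by linarith
  then have e3: "e * (8 * D^3) \<le> K" using K_pos by (simp add: field_simps)
  have "e * K < 1"
  proof -
    have "0 < e * D" "0 < e * K" using e D_pos K_pos by auto
    then show ?thesis using e2 by (simp add: algebra_simps)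
  qed
  define r where "r = sqrt (1 - e * K)"
  have r: "0 < r" "r < 1" "r^2 = 1 - e * K"
    using \<open>e * K < 1\<close> e K_pos by (auto simp: r_def real_less_lsqrt)
  have bound: "\<bar>f x - f y\<bar> \<le> 4 * e * D / (1 - r)"
    if f: "unit_gradient f" and x: "x \<in> pverts H" and y: "y \<in> pverts H" for f x y
  proof -
    define S where "S = (\<lambda>h. \<bar>h x - h y\<bar>) ` {h. unit_gradient h}"
    obtain n where "(x, y) \<in> parcs H ^^ n" using conn [OF x y] rtrancl_imp_relpow by blast
    then have bdd: "bdd_above S"
      unfolding S_def using unit_gradient_path x by (intro bdd_aboveI2) auto
    have le_Sup: "\<bar>h x - h y\<bar> \<le> Sup S" if "unit_gradient h" for h
      using bdd that by (intro cSup_upper) (auto simp: S_def)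
    have "\<bar>h x - h y\<bar> \<le> r * Sup S + 4 * e * D" if h: "unit_gradient h" for h
    proof -
      define g where "g = (\<lambda>z. h z + e * laplace H h z)"
      have "unit_gradient (\<lambda>z. g z / r)"
        unfolding unit_gradient_def
      proof
        fix z assume "z \<in> pverts H"
        then have "Gam H g g z \<le> r^2"
          unfolding g_def r(3) by (intro Euler_step_contracts_gradient h e e2 e3)
        then show "Gam H (\<lambda>z. g z / r) (\<lambda>z. g z / r) z \<le> 1"
          using r(1) by (simp add: Gam_divide)
      qed
      from le_Sup [OF this] have "\<bar>g x - g y\<bar> / r \<le> Sup S"
        using r by (simp flip: diff_divide_distrib)
      then have "\<bar>g x - g y\<bar> \<le> r * Sup S" using r by (simp add: field_simps)
      moreover have "\<bar>g z - h z\<bar> \<le> e * (2 * D)" if "z \<in> pverts H" for z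
        using laplace_le [OF h that] e by (simp add: g_def abs_mult)
      note this [OF x] this [OF y]
      ultimately show ?thesis by linarith
    qed
    then have "Sup S \<le> r * Sup S + 4 * e * D"
      using f by (intro cSup_least) (auto simp: S_def)
    then have "Sup S \<le> 4 * e * D / (1 - r)" using r by (simp add: field_simps)
    with le_Sup [OF f] show ?thesis by linarith
  qed
  show ?thesis by (rule that) (rule bound)
qed

lemma finite_sphere:
  assumes "x \<in> pverts H"
  shows "finite {y. (x, y) \<in> parcs H ^^ n}"
proof (induction n)
  case (Suc n)
  have "{y. (x, y) \<in> parcs H ^^ Suc n} \<subseteq> (\<Union>z\<in>{z. (x, z) \<in> parcs H ^^ n} \<inter> pverts H. nbrs H z)"
    using in_arcsD1 by (fastforce simp: nbrs_def)
  moreover have "finite \<dots>" using Suc finite_nbrs by auto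
  ultimately show ?case by (rule finite_subset)
qed simp

text \<open>
  The distance from a vertex is $1$-Lipschitz, so a multiple of it has gradient at most $1$ and
  hence bounded oscillation. All vertices then lie in one ball, and balls are finite.
\<close>
lemma finite_pverts:
  assumes conn: "\<And>x y. x \<in> pverts H \<Longrightarrow> y \<in> pverts H \<Longrightarrow> (x, y) \<in> (parcs H)\<^sup>*"
  shows "finite (pverts H)"
proof (cases "pverts H = {}")
  case False
  then obtain v\<^sub>0 where v0: "v\<^sub>0 \<in> pverts H" by blast
  define d where "d y = (LEAST n. (v\<^sub>0, y) \<in> parcs H ^^ n)" for y
  have d: "(v\<^sub>0, y) \<in> parcs H ^^ d y" if y: "y \<in> pverts H" for y
  proof -
    obtain n where "(v\<^sub>0, y) \<in> parcs H ^^ n" using conn [OF v0 y] rtrancl_imp_relpow by blast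
    then show ?thesis unfolding d_def by (rule LeastI)
  qed
  have d_step: "d y \<le> Suc (d x)" if "(x, y) \<in> parcs H" for x y
  proof -
    have "x \<in> pverts H" using that in_arcsD1 by blast
    then have "(v\<^sub>0, y) \<in> parcs H ^^ Suc (d x)" using d that by auto
    then show ?thesis unfolding d_def by (rule Least_le)
  qed
  have "unit_gradient (\<lambda>y. real (d y) / sqrt D)"
    unfolding unit_gradient_def
  proof
    fix x assume x: "x \<in> pverts H"
    have "Gam H (\<lambda>y. real (d y)) (\<lambda>y. real (d y)) x \<le> D * 1^2 / 2"
    proof (rule Gam_le_of_Lipschitz [OF x])
      fix y assume "y \<in> nbrs H x"
      then have "(x, y) \<in> parcs H" "(y, x) \<in> parcs H"
        using arcs_symmetric by (auto simp: nbrs_def)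
      then show "\<bar>real (d y) - real (d x)\<bar> \<le> 1"
        using d_step [of x y] d_step [of y x] by linarith
    qed
    then show "Gam H (\<lambda>y. real (d y) / sqrt D) (\<lambda>y. real (d y) / sqrt D) x \<le> 1"
      using D_pos by (simp add: Gam_divide)
  qed
  moreover obtain B where
    "\<And>f x y. unit_gradient f \<Longrightarrow> x \<in> pverts H \<Longrightarrow> y \<in> pverts H \<Longrightarrow> \<bar>f x - f y\<bar> \<le> B"
    using unit_gradient_bounded_oscillation conn by blast
  ultimately have osc: "\<bar>real (d y) / sqrt D - real (d v\<^sub>0) / sqrt D\<bar> \<le> B"
    if "y \<in> pverts H" for y
    using v0 that by blast
  have "d v\<^sub>0 = 0" unfolding d_def by (rule Least_eq_0) simp
  then have "real (d y) \<le> sqrt D * B" if "y \<in> pverts H" for y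
    using osc [OF that] D_pos by (simp add: field_simps)
  then have "d y \<le> nat \<lfloor>sqrt D * B\<rfloor>" if "y \<in> pverts H" for y
    using that by (simp add: le_nat_floor)
  then have "pverts H \<subseteq> (\<Union>n\<le>nat \<lfloor>sqrt D * B\<rfloor>. {y. (v\<^sub>0, y) \<in> parcs H ^^ n})"
    using d by blast
  then show ?thesis
    by (rule finite_subset) (use finite_sphere [OF v0] in auto)
qed simp

end

section \<open>Coverings preserving short circuits are injective on two-balls\<close>

lemma circuit3_iff:
  fixes F :: "'c pair_pre_digraph"
  assumes "pair_wf_digraph F"
  shows "circuit F [a, b, c] \<longleftrightarrow>
    distinct [a, b, c] \<and> b \<in> nbrs F a \<and> c \<in> nbrs F b \<and> a \<in> nbrs F c"
  using pair_wf_digraph.in_arcsD1 [OF assms] pair_wf_digraph.in_arcsD2 [OF assms]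
  by (auto simp: circuit_def vpath_def vwalk_def nbrs_def)

lemma circuit4_iff:
  fixes F :: "'c pair_pre_digraph"
  assumes "pair_wf_digraph F"
  shows "circuit F [a, b, c, d] \<longleftrightarrow>
    distinct [a, b, c, d] \<and> b \<in> nbrs F a \<and> c \<in> nbrs F b \<and> d \<in> nbrs F c \<and> a \<in> nbrs F d"
  using pair_wf_digraph.in_arcsD1 [OF assms] pair_wf_digraph.in_arcsD2 [OF assms]
  by (auto simp: circuit_def vpath_def vwalk_def nbrs_def)

locale short_circuit_covering = G: pair_graph G + H: pair_bidirected_digraph H
  for G :: "'a pair_pre_digraph" and H :: "'b pair_pre_digraph" +
  fixes \<Psi> :: "'b \<Rightarrow> 'a"
  assumes covering: "covering G H \<Psi>"
    and preserving: "preserving {xs. circuit G xs \<and> (length xs = 3 \<or> length xs = 4)} H \<Psi>"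
begin

lemma nbr_pverts: "y \<in> nbrs H x \<Longrightarrow> x \<in> pverts H \<and> y \<in> pverts H"
  using H.in_arcsD1 H.in_arcsD2 by (auto simp: nbrs_def)

lemma nbr_sym: "y \<in> nbrs H x \<Longrightarrow> x \<in> nbrs H y"
  using H.arcs_symmetric by (auto simp: nbrs_def)

lemma nbr_image: "y \<in> nbrs H x \<Longrightarrow> \<Psi> y \<in> nbrs G (\<Psi> x)"
  using covering by (auto simp: covering_def graph_hom_def nbrs_def)

lemma bij_betw_nbrs: "x \<in> pverts H \<Longrightarrow> bij_betw \<Psi> (nbrs H x) (nbrs G (\<Psi> x))"
  using covering by (auto simp: covering_def)

lemma nbr_eqI: "y \<in> nbrs H x \<Longrightarrow> z \<in> nbrs H x \<Longrightarrow> \<Psi> y = \<Psi> z \<Longrightarrow> y = z"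
  using bij_betw_nbrs nbr_pverts unfolding bij_betw_def inj_on_def by blast

lemma base_nbr_sym: "v \<in> nbrs G u \<Longrightarrow> u \<in> nbrs G v"
  using G.arcs_symmetric by (auto simp: nbrs_def)

lemma base_nbr_neq: "v \<in> nbrs G u \<Longrightarrow> v \<noteq> u"
  using G.pair_no_loops by (force simp: nbrs_def)

lemma circuit_lift:
  assumes "circuit G (map \<Psi> xs)" "length xs = 3 \<or> length xs = 4" "hd xs \<in> pverts H"
  obtains ys where "circuit H ys" "hd ys = hd xs" "map \<Psi> ys = map \<Psi> xs"
proof -
  have "\<Psi> (hd xs) = hd (map \<Psi> xs)" using assms(2) by (cases xs) auto
  then show ?thesis
    using preserving assms that unfolding preserving_def
    by (metis (mono_tags, lifting) length_map mem_Collect_eq)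
qed

text \<open>
  The lift of a triangle at \<^term>\<open>x\<close> has to follow the given path \<^term>\<open>x\<close>, \<^term>\<open>y\<close>, \<^term>\<open>z\<close>, because
  lifts of neighbours are unique.
\<close>
lemma triangle_closes:
  assumes y: "y \<in> nbrs H x" and z: "z \<in> nbrs H y" and c: "\<Psi> z \<in> nbrs G (\<Psi> x)"
  shows "z \<in> nbrs H x"
proof -
  have "circuit G (map \<Psi> [x, y, z])"
    using nbr_image [OF y] nbr_image [OF z] c base_nbr_sym base_nbr_neq
    by (auto simp: circuit3_iff [OF G.pair_wf_digraph_axioms])
  then obtain ys where ys: "circuit H ys" "hd ys = x" "map \<Psi> ys = map \<Psi> [x, y, z]"
    using nbr_pverts [OF y] by (auto intro: circuit_lift [of "[x, y, z]"])
  then obtain y' z' where "ys = [x, y', z']" and im: "\<Psi> y' = \<Psi> y" "\<Psi> z' = \<Psi> z"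
    by (auto simp: map_eq_Cons_conv)
  with ys(1) have n: "y' \<in> nbrs H x" "z' \<in> nbrs H y'" "x \<in> nbrs H z'"
    by (auto simp: circuit3_iff [OF H.pair_wf_digraph_axioms])
  then have "y' = y" using nbr_eqI y im by blast
  then have "z' = z" using nbr_eqI z im n by blast
  then show ?thesis using n nbr_sym by blast
qed

text \<open>
  Two paths of length two from \<^term>\<open>x\<close> whose images form a 4-circuit must meet already in the
  covering graph, again by uniqueness of lifts; in the degenerate cases the images share
  an edge or go back, and then local injectivity alone decides.
\<close>
lemma two_step_eqI:
  assumes y: "y \<in> nbrs H x" "y' \<in> nbrs H x"
    and z: "z \<in> nbrs H y" "z' \<in> nbrs H y'" and eq: "\<Psi> z = \<Psi> z'"
  shows "z = z'"
proof -
  consider "\<Psi> z = \<Psi> x" | "\<Psi> y = \<Psi> y'" | "\<Psi> z \<noteq> \<Psi> x" "\<Psi> y \<noteq> \<Psi> y'" by blast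
  then show ?thesis
  proof cases
    case 1
    then have "z = x" "z' = x" using y z eq nbr_eqI nbr_sym by metis+
    then show ?thesis by simp
  next
    case 2
    then have "y = y'" using y nbr_eqI by blast
    then show ?thesis using z eq nbr_eqI by blast
  next
    case 3
    note images = nbr_image [OF y(1)] nbr_image [OF y(2)] nbr_image [OF z(1)] nbr_image [OF z(2)]
    have "circuit G (map \<Psi> [x, y, z, y'])"
      using images 3 eq base_nbr_sym base_nbr_neq
      by (auto simp: circuit4_iff [OF G.pair_wf_digraph_axioms])
    then obtain ys where ys: "circuit H ys" "hd ys = x" "map \<Psi> ys = map \<Psi> [x, y, z, y']"
      using nbr_pverts [OF y(1)] by (auto intro: circuit_lift [of "[x, y, z, y']"])
    then obtain a b c where "ys = [x, a, b, c]" and im: "\<Psi> a = \<Psi> y" "\<Psi> b = \<Psi> z" "\<Psi> c = \<Psi> y'"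
      by (auto simp: map_eq_Cons_conv)
    with ys(1) have n: "a \<in> nbrs H x" "b \<in> nbrs H a" "c \<in> nbrs H b" "x \<in> nbrs H c"
      by (auto simp: circuit4_iff [OF H.pair_wf_digraph_axioms])
    have "a = y" using nbr_eqI n(1) y(1) im by blast
    then have "b = z" using nbr_eqI n(2) z(1) im by blast
    have "c = y'" using nbr_eqI nbr_sym [OF n(4)] y(2) im by blast
    then have "z \<in> nbrs H y'" using nbr_sym [OF n(3)] \<open>b = z\<close> by simp
    then show ?thesis using nbr_eqI z(2) eq by blast
  qed
qed

definition two_ball :: "'b \<Rightarrow> 'b set" where
  "two_ball x = {x} \<union> nbrs H x \<union> (\<Union>y\<in>nbrs H x. nbrs H y)"

lemma inj_on_two_ball: "inj_on \<Psi> (two_ball x)"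
proof -
  have centre: "u = x" if u: "u \<in> two_ball x" and eq: "\<Psi> u = \<Psi> x" for u
  proof -
    have "u \<notin> nbrs H x" using nbr_image [of u x] base_nbr_neq eq by metis
    then consider "u = x" | y where "y \<in> nbrs H x" "u \<in> nbrs H y"
      using u unfolding two_ball_def by blast
    then show ?thesis by cases (use eq nbr_eqI nbr_sym in auto)
  qed
  have near: "u = v" if u: "u \<in> nbrs H x" and v: "v \<in> two_ball x" and eq: "\<Psi> u = \<Psi> v" for u v
  proof -
    have img: "\<Psi> v \<in> nbrs G (\<Psi> x)" using nbr_image [OF u] eq by simp
    then have "v \<noteq> x" using base_nbr_neq by blast
    then have "v \<in> nbrs H x"
      using v img triangle_closes unfolding two_ball_def by blast
    then show ?thesis using nbr_eqI u eq by blast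
  qed
  show ?thesis
  proof (rule inj_onI)
    fix u v assume *: "u \<in> two_ball x" "v \<in> two_ball x" "\<Psi> u = \<Psi> v"
    consider "u = x" | "v = x" | "u \<in> nbrs H x" | "v \<in> nbrs H x"
      | y y' where "y \<in> nbrs H x" "u \<in> nbrs H y" "y' \<in> nbrs H x" "v \<in> nbrs H y'"
      using * unfolding two_ball_def by blast
    then show "u = v"
    proof cases
      case 1
      then show ?thesis using centre [OF *(2)] *(3) by simp
    next
      case 2
      then show ?thesis using centre [OF *(1)] *(3) by simp
    next
      case 3
      then show ?thesis using near *(2,3) by simp
    next
      case 4
      then show ?thesis using near [OF 4 *(1)] *(3) by simp
    next
      case 5
      then show ?thesis using two_step_eqI *(3) by blast
    qed
  qed
qed

section \<open>Transfer of curvature to the covering graph\<close>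

lemma laplace_lift:
  assumes "x \<in> pverts H" "f (\<Psi> x) = h x" "\<And>y. y \<in> nbrs H x \<Longrightarrow> f (\<Psi> y) = h y"
  shows "laplace G f (\<Psi> x) = laplace H h x"
proof -
  have "(\<Sum>v\<in>nbrs G (\<Psi> x). f v - f (\<Psi> x)) = (\<Sum>y\<in>nbrs H x. f (\<Psi> y) - f (\<Psi> x))"
    by (rule sum.reindex_bij_betw [OF bij_betw_nbrs [OF assms(1)], symmetric])
  also have "\<dots> = (\<Sum>y\<in>nbrs H x. h y - h x)"
    using assms by (intro sum.cong) auto
  finally show ?thesis by (simp add: laplace_def)
qed

lemma Gam_lift:
  assumes "x \<in> pverts H" "f (\<Psi> x) = h x" "\<And>y. y \<in> nbrs H x \<Longrightarrow> f (\<Psi> y) = h y"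
    and "g (\<Psi> x) = k x" "\<And>y. y \<in> nbrs H x \<Longrightarrow> g (\<Psi> y) = k y"
  shows "Gam G f g (\<Psi> x) = Gam H h k x"
proof -
  have "laplace G (\<lambda>y. f y * g y) (\<Psi> x) = laplace H (\<lambda>y. h y * k y) x"
    using assms by (intro laplace_lift) auto
  then show ?thesis
    using assms laplace_lift [of x f h] laplace_lift [of x g k] by (simp add: Gam_def)
qed

lemma Gam2_lift:
  assumes x: "x \<in> pverts H" and eq: "\<And>y. y \<in> two_ball x \<Longrightarrow> f (\<Psi> y) = h y"
  shows "Gam2 G f f (\<Psi> x) = Gam2 H h h x"
proof -
  have y: "y \<in> pverts H" "f (\<Psi> y) = h y" "\<And>z. z \<in> nbrs H y \<Longrightarrow> f (\<Psi> z) = h z"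
    if "y = x \<or> y \<in> nbrs H x" for y
    using that x eq nbr_pverts unfolding two_ball_def by auto
  have lap: "laplace G f (\<Psi> y) = laplace H h y" if "y = x \<or> y \<in> nbrs H x" for y
    using y [OF that] by (intro laplace_lift)
  have gam: "Gam G f f (\<Psi> y) = Gam H h h y" if "y = x \<or> y \<in> nbrs H x" for y
    using y [OF that] by (intro Gam_lift)
  have "laplace G (Gam G f f) (\<Psi> x) = laplace H (Gam H h h) x"
    using x gam by (intro laplace_lift) auto
  moreover have "Gam G f (laplace G f) (\<Psi> x) = Gam H h (laplace H h) x"
    using x y lap by (intro Gam_lift) auto
  ultimately show ?thesis by (simp add: Gam2_self)
qed

text \<open>
  At a vertex \<^term>\<open>x\<close> the curvature inequality only sees the values of the function on the ball of
  radius two. As \<^term>\<open>\<Psi>\<close> is injective there, any such values are the pullback of a function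
  on the base graph.
\<close>
lemma CD_inf_lift:
  assumes "CD_inf G K"
  shows "CD_inf H K"
  unfolding CD_inf_def
proof (intro allI ballI)
  fix h :: "'b \<Rightarrow> real" and x assume x: "x \<in> pverts H"
  define f where "f v = h (inv_into (two_ball x) \<Psi> v)" for v
  have eq: "f (\<Psi> y) = h y" if "y \<in> two_ball x" for y
    using that by (simp add: f_def inv_into_f_f [OF inj_on_two_ball])
  have "Gam G f f (\<Psi> x) = Gam H h h x"
    using x eq by (intro Gam_lift) (auto simp: two_ball_def)
  moreover have "Gam2 G f f (\<Psi> x) = Gam2 H h h x"
    using x eq by (rule Gam2_lift)
  moreover have "\<Psi> x \<in> pverts G"
    using covering x by (auto simp: covering_def)
  ultimately show "Gam2 H h h x \<ge> K * Gam H h h x"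
    using assms unfolding CD_inf_def by metis
qed

lemma nbrs_bounded:
  assumes "x \<in> pverts H"
  shows "finite (nbrs H x)" "card (nbrs H x) \<le> card (pverts G)"
proof -
  have sub: "nbrs G (\<Psi> x) \<subseteq> pverts G" using G.in_arcsD2 by (auto simp: nbrs_def)
  then have "finite (nbrs G (\<Psi> x))" using G.pair_finite_verts finite_subset by blast
  then show "finite (nbrs H x)" using bij_betw_finite [OF bij_betw_nbrs [OF assms]] by simp
  show "card (nbrs H x) \<le> card (pverts G)"
    using bij_betw_same_card [OF bij_betw_nbrs [OF assms]] card_mono [OF G.pair_finite_verts sub]
    by simp
qed

end

section \<open>Infinite coverings of positively curved graphs\<close>

theorem theorem3p1:
  fixes G :: "'a pair_pre_digraph" and K :: real
  assumes "pair_graph G"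
    and "Digraph_Component.connected G"
    and "K > 0"
    and "CD_inf G K"
  shows "\<not> (\<exists>(H :: 'b pair_pre_digraph) \<Psi>.
            covering G H \<Psi> \<and> Digraph_Component.connected H \<and> infinite (pverts H) \<and>
            preserving {xs. circuit G xs \<and> (length xs = 3 \<or> length xs = 4)} H \<Psi>)"
proof (intro notI, elim exE conjE)
  fix H :: "'b pair_pre_digraph" and \<Psi> :: "'b \<Rightarrow> 'a"
  assume cov: "covering G H \<Psi>" and conn: "Digraph_Component.connected H"
    and inf: "infinite (pverts H)"
    and pres: "preserving {xs. circuit G xs \<and> (length xs = 3 \<or> length xs = 4)} H \<Psi>"
  interpret G: pair_graph G by fact
  interpret H: pair_bidirected_digraph H using cov by (simp add: covering_def)
  interpret short_circuit_covering G H \<Psi> by unfold_locales (fact cov pres)+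
  have "pverts G \<noteq> {}" using inf cov by (auto simp: covering_def)
  then have "real (card (pverts G)) > 0" using G.pair_finite_verts by (simp add: card_gt_0_iff)
  then interpret positively_curved H K "real (card (pverts G))"
    using nbrs_bounded CD_inf_lift assms by unfold_locales auto
  have "Digraph_Component.strongly_connected H"
    using H.symmetric_connected_imp_strongly_connected H.sym_arcs conn by blast
  then have "(x, y) \<in> (parcs H)\<^sup>*" if "x \<in> pverts H" "y \<in> pverts H" for x y
    using that unfolding strongly_connected_def reachable_def
    by (auto dest: rtrancl_on_rtranclI)
  then have "finite (pverts H)" by (rule finite_pverts)
  with inf show False by blast
qed

end
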